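(* Let $X$ be a set, let $\rho$ be an $R_0$ topology on $X$ such that $X$ is the union of infinitely many pairwise disjoint point closures $cl_\rho(x)$, and let $\tau\in\mathcal{L}_\rho$ be regular. Then $\tau$ is minimal regular in $\mathcal{L}_\rho$ if and only if every $\tau$-regular filter $\mathcal{F}$ on $X$ such that $adh_\tau\mathcal{F}=cl_\tau(x)$ for some $x\in X$ is $\tau$-convergent (necessarily to every point of $cl_\tau(x)$).
   Context: Topologies on $X$ are ordered by inclusion ($\leq$ means $\subseteq$). For a topology $\tau$, $cl_\tau(A)$ is the $\tau$-closure of $A$ and $cl_\tau(x)=cl_\tau(\{x\})$ (a point closure). $\tau$ is $R_0$ if for all $x,y\in X$, $x\in cl_\tau(y)$ iff $y\in cl_\tau(x)$ (equivalently, the point closures partition $X$). $\tau$ is regular (no $T_1$ or $T_0$ assumed) if for each $V\in\tau$ and $x\in V$ there is $U\in\tau$ with $x\in U\subseteq cl_\tau(U)\subseteq V$. For a topology $\rho$ on $X$, $\mathcal{L}_\rho=\{\tau : \tau \text{ a topology on } X,\ at(\rho)\leq\tau\leq\overline{\rho}\}$, where $at(\rho)$ is the topology generated by the sets $X\setminus cl_\rho(H)$ with $H\subseteq X$ finite, and $\overline{\rho}$ is the closure of $\rho$ in $2^X=\{0,1\}^X$ with the product topology (sets identified with characteristic functions); $\overline\rho$ is the smallest topology containing $\rho$ that is closed under arbitrary intersections, i.e. the family of all sets that are intersections of $\rho$-open sets. $\tau\in\mathcal{L}_\rho$ is minimal regular in $\mathcal{L}_\rho$ if $\tau$ is regular and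 no member of $\mathcal{L}_\rho$ strictly contained in $\tau$ is regular. A $\tau$-open filter is a (proper) filter consisting of $\tau$-open sets, i.e. a nonempty family of nonempty $\tau$-open sets closed under finite intersections and under passing to $\tau$-open supersets. A $\tau$-regular filter is a $\tau$-open filter $\mathcal{F}$ such that for every $F\in\mathcal{F}$ there is $F'\in\mathcal{F}$ with $cl_\tau(F')\subseteq F$. $adh_\tau\mathcal{F}=\bigcap_{F\in\mathcal{F}}cl_\tau(F)$. $\mathcal{N}_\tau(x)$ is the family of $\tau$-open sets containing $x$; $\mathcal{F}$ is $\tau$-convergent to $x$ if $\mathcal{F}\supseteq\mathcal{N}_\tau(x)$, and $\tau$-convergent if it is $\tau$-convergent to some point. *)

theory Defs
  imports "HOL-Analysis.Analysis"
begin

text \<open>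
  Throughout, a topology on a set \<open>X\<close> is a value of type \<^typ>\<open>'a topology\<close> whose
  \<^const>\<open>topspace\<close> is \<open>X\<close>; the order on topologies is inclusion of the families of open sets.
\<close>

definition R0_space :: "'a topology \<Rightarrow> bool" where
  "R0_space T \<longleftrightarrow>
     (\<forall>x \<in> topspace T. \<forall>y \<in> topspace T. x \<in> T closure_of {y} \<longleftrightarrow> y \<in> T closure_of {x})"

definition point_closures :: "'a topology \<Rightarrow> 'a set set" where
  "point_closures T = {T closure_of {x} | x. x \<in> topspace T}"

text \<open>Taking \<open>H = {}\<close> shows that the generated topology has the same underlying set.\<close>

definition at_topology :: "'a topology \<Rightarrow> 'a topology" where
  "at_topology R = topology_generated_by
     {topspace R - R closure_of H | H. finite H \<and> H \<subseteq> topspace R}"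

text \<open>
  Subsets of \<open>X\<close> are identified with elements of \<open>2\<^sup>X\<close>, rendered as extensional functions from
  \<open>X\<close> to \<^typ>\<open>bool\<close>.
\<close>

definition charfun :: "'a set \<Rightarrow> 'a set \<Rightarrow> 'a \<Rightarrow> bool" where
  "charfun X A = (\<lambda>x\<in>X. x \<in> A)"

definition cantor_closure :: "'a topology \<Rightarrow> 'a set set" where
  "cantor_closure R =
     {A. A \<subseteq> topspace R \<and>
         charfun (topspace R) A \<in>
           product_topology (\<lambda>_. discrete_topology (UNIV :: bool set)) (topspace R)
             closure_of (charfun (topspace R) ` {U. openin R U})}"

definition topology_interval :: "'a topology \<Rightarrow> 'a topology set" where
  "topology_interval R =
     {T. topspace T = topspace R \<and>
         {U. openin (at_topology R) U} \<subseteq> {U. openin T U} \<and>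
         {U. openin T U} \<subseteq> cantor_closure R}"

definition minimal_regular_in :: "'a topology set \<Rightarrow> 'a topology \<Rightarrow> bool" where
  "minimal_regular_in L T \<longleftrightarrow>
     T \<in> L \<and> regular_space T \<and>
     \<not> (\<exists>S \<in> L. {U. openin S U} \<subset> {U. openin T U} \<and> regular_space S)"

definition open_filter :: "'a topology \<Rightarrow> 'a set set \<Rightarrow> bool" where
  "open_filter T F \<longleftrightarrow>
     F \<noteq> {} \<and>
     (\<forall>U \<in> F. openin T U \<and> U \<noteq> {}) \<and>
     (\<forall>U \<in> F. \<forall>V \<in> F. U \<inter> V \<in> F) \<and>
     (\<forall>U \<in> F. \<forall>V. openin T V \<and> U \<subseteq> V \<longrightarrow> V \<in> F)"

definition regular_filter :: "'a topology \<Rightarrow> 'a set set \<Rightarrow> bool" where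
  "regular_filter T F \<longleftrightarrow>
     open_filter T F \<and> (\<forall>U \<in> F. \<exists>V \<in> F. T closure_of V \<subseteq> U)"

definition adherence :: "'a topology \<Rightarrow> 'a set set \<Rightarrow> 'a set" where
  "adherence T F = (\<Inter>U \<in> F. T closure_of U)"

definition open_nhds :: "'a topology \<Rightarrow> 'a \<Rightarrow> 'a set set" where
  "open_nhds T x = {U. openin T U \<and> x \<in> U}"

definition converges_to :: "'a topology \<Rightarrow> 'a set set \<Rightarrow> 'a \<Rightarrow> bool" where
  "converges_to T F x \<longleftrightarrow> open_nhds T x \<subseteq> F"

definition is_convergent :: "'a topology \<Rightarrow> 'a set set \<Rightarrow> bool" where
  "is_convergent T F \<longleftrightarrow> (\<exists>x \<in> topspace T. converges_to T F x)"

text \<open>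
  The library's \<^const>\<open>regular_space\<close> assumes no separation axiom, and agrees with the formulation
  by closed neighbourhoods.
\<close>

lemma regular_space_iff_open_closure:
  "regular_space T \<longleftrightarrow>
     (\<forall>V x. openin T V \<and> x \<in> V \<longrightarrow>
        (\<exists>U. openin T U \<and> x \<in> U \<and> U \<subseteq> T closure_of U \<and> T closure_of U \<subseteq> V))"
proof -
  have "(\<exists>U C. openin T U \<and> closedin T C \<and> x \<in> U \<and> U \<subseteq> C \<and> C \<subseteq> V) \<longleftrightarrow>
        (\<exists>U. openin T U \<and> x \<in> U \<and> U \<subseteq> T closure_of U \<and> T closure_of U \<subseteq> V)" for V x
  proof
    assume "\<exists>U C. openin T U \<and> closedin T C \<and> x \<in> U \<and> U \<subseteq> C \<and> C \<subseteq> V"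
    then obtain U C where "openin T U" "closedin T C" "x \<in> U" "U \<subseteq> C" "C \<subseteq> V"
      by blast
    moreover from this have "T closure_of U \<subseteq> V"
      using closure_of_minimal [of U C T] by blast
    moreover have "U \<subseteq> T closure_of U"
      using \<open>openin T U\<close> by (intro closure_of_subset openin_subset)
    ultimately show "\<exists>U. openin T U \<and> x \<in> U \<and> U \<subseteq> T closure_of U \<and> T closure_of U \<subseteq> V"
      by blast
  next
    assume "\<exists>U. openin T U \<and> x \<in> U \<and> U \<subseteq> T closure_of U \<and> T closure_of U \<subseteq> V"
    then show "\<exists>U C. openin T U \<and> closedin T C \<and> x \<in> U \<and> U \<subseteq> C \<and> C \<subseteq> V"
      using closedin_closure_of [of T] by blast
  qed
  then show ?thesis
    unfolding neighbourhood_base_of_closedin [symmetric] neighbourhood_base_of by simp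
qed

lemma topspace_at_topology: "topspace (at_topology R) = topspace R"
proof -
  have "topspace R \<in> {topspace R - R closure_of H | H. finite H \<and> H \<subseteq> topspace R}"
    by (rule CollectI, rule exI [of _ "{}"]) simp
  then show ?thesis
    unfolding at_topology_def topology_generated_by_topspace by blast
qed

text \<open>
  The closure in \<open>2\<^sup>X\<close> consists of the intersections of open sets (with the empty intersection
  read as \<open>X\<close>, which is itself open).
\<close>

lemma cantor_closure_pointwise:
  "A \<in> cantor_closure R \<longleftrightarrow>
     A \<subseteq> topspace R \<and>
     (\<forall>F. finite F \<and> F \<subseteq> topspace R \<longrightarrow> (\<exists>U. openin R U \<and> U \<inter> F = A \<inter> F))"
    (is "_ \<longleftrightarrow> ?sub \<and> ?fin")
proof (cases "A \<subseteq> topspace R")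
  case True
  define X where "X = topspace R"
  define P where "P = product_topology (\<lambda>_. discrete_topology (UNIV :: bool set)) X"
  have top: "charfun X A \<in> topspace P" by (simp add: P_def charfun_def)
  have "charfun X A \<in> P closure_of (charfun X ` {U. openin R U}) \<longleftrightarrow> ?fin"
  proof
    assume cl: "charfun X A \<in> P closure_of (charfun X ` {U. openin R U})"
    show ?fin
    proof (intro allI impI)
      fix F assume F: "finite F \<and> F \<subseteq> topspace R"
      define W where "W = (\<Pi>\<^sub>E i\<in>X. if i \<in> F then {i \<in> A} else (UNIV :: bool set))"
      have "{i. (if i \<in> F then {i \<in> A} else (UNIV :: bool set)) \<noteq> UNIV} \<subseteq> F" by auto
      then have "openin P W"
        unfolding P_def W_def
        using F finite_subset by (intro product_topology_basis) (simp, force)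
      moreover have "charfun X A \<in> W" by (auto simp: W_def charfun_def)
      ultimately obtain U where U: "openin R U" "charfun X U \<in> W"
        using cl unfolding closure_of_def by blast
      have "i \<in> U \<longleftrightarrow> i \<in> A" if "i \<in> F" for i
      proof -
        have "i \<in> X" using that F X_def by auto
        then have "charfun X U i \<in> (if i \<in> F then {i \<in> A} else UNIV)"
          using U(2) unfolding W_def by (rule PiE_mem [rotated])
        then show ?thesis using that \<open>i \<in> X\<close> by (simp add: charfun_def)
      qed
      then show "\<exists>U. openin R U \<and> U \<inter> F = A \<inter> F" using U(1) by blast
    qed
  next
    assume fin: ?fin
    show "charfun X A \<in> P closure_of (charfun X ` {U. openin R U})"
      unfolding in_closure_of
    proof (intro conjI top allI impI)
      fix W assume W: "charfun X A \<in> W \<and> openin P W"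
      then obtain V where V: "finite {i \<in> X. V i \<noteq> UNIV}"
          "charfun X A \<in> Pi\<^sub>E X V" "Pi\<^sub>E X V \<subseteq> W"
        unfolding P_def openin_product_topology_alt by auto
      define F where "F = {i \<in> X. V i \<noteq> UNIV}"
      have "finite F \<and> F \<subseteq> topspace R" using V(1) by (auto simp: F_def X_def)
      with fin obtain U where U: "openin R U" "U \<inter> F = A \<inter> F" by blast
      have "charfun X U i \<in> V i" if "i \<in> X" for i
      proof (cases "i \<in> F")
        case True
        then have "charfun X U i = charfun X A i" using U(2) by (auto simp: charfun_def)
        then show ?thesis using V(2) that by auto
      next
        case False
        then show ?thesis using that by (auto simp: F_def)
      qed
      then have "charfun X U \<in> Pi\<^sub>E X V" by (auto simp: charfun_def)
      then show "\<exists>y. y \<in> charfun X ` {U. openin R U} \<and> y \<in> W" using U(1) V(3) by blast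
    qed
  qed
  then show ?thesis using True unfolding cantor_closure_def P_def X_def by simp
qed (auto simp: cantor_closure_def)

lemma cantor_closure_eq_Inter:
  "A \<in> cantor_closure R \<longleftrightarrow> (\<exists>\<U>. (\<forall>U \<in> \<U>. openin R U) \<and> A = topspace R \<inter> \<Inter>\<U>)"
proof
  assume A: "A \<in> cantor_closure R"
  then have sub: "A \<subseteq> topspace R" by (simp add: cantor_closure_pointwise)
  have sep: "\<exists>U. openin R U \<and> A \<subseteq> U \<and> y \<notin> U" if y: "y \<in> topspace R - A" for y
  proof -
    have "\<exists>U. openin R U \<and> x \<in> U \<and> y \<notin> U" if "x \<in> A" for x
    proof -
      have "finite {x, y} \<and> {x, y} \<subseteq> topspace R" using that y sub by auto
      then obtain U where "openin R U" "U \<inter> {x, y} = A \<inter> {x, y}"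
        using A unfolding cantor_closure_pointwise by blast
      then show ?thesis using that y by blast
    qed
    then have "A \<subseteq> \<Union>{U. openin R U \<and> y \<notin> U}" by blast
    moreover have "openin R (\<Union>{U. openin R U \<and> y \<notin> U})" by blast
    ultimately show ?thesis by blast
  qed
  show "\<exists>\<U>. (\<forall>U \<in> \<U>. openin R U) \<and> A = topspace R \<inter> \<Inter>\<U>"
  proof (intro exI conjI)
    show "\<forall>U \<in> {U. openin R U \<and> A \<subseteq> U}. openin R U" by simp
    show "A = topspace R \<inter> \<Inter>{U. openin R U \<and> A \<subseteq> U}"
    proof
      show "A \<subseteq> topspace R \<inter> \<Inter>{U. openin R U \<and> A \<subseteq> U}" using sub by blast
      show "topspace R \<inter> \<Inter>{U. openin R U \<and> A \<subseteq> U} \<subseteq> A"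
      proof
        fix y assume y: "y \<in> topspace R \<inter> \<Inter>{U. openin R U \<and> A \<subseteq> U}"
        show "y \<in> A"
        proof (rule ccontr)
          assume "y \<notin> A"
          then obtain U where "openin R U" "A \<subseteq> U" "y \<notin> U" using sep [of y] y by blast
          then show False using y by blast
        qed
      qed
    qed
  qed
next
  assume "\<exists>\<U>. (\<forall>U \<in> \<U>. openin R U) \<and> A = topspace R \<inter> \<Inter>\<U>"
  then obtain \<U> where \<U>: "\<forall>U \<in> \<U>. openin R U" "A = topspace R \<inter> \<Inter>\<U>" by blast
  have "\<exists>U. openin R U \<and> U \<inter> F = A \<inter> F" if F: "finite F" "F \<subseteq> topspace R" for F
  proof -
    have "\<forall>y \<in> F - A. \<exists>U. U \<in> \<U> \<and> y \<notin> U" using F \<U>(2) by blast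
    then obtain g where g: "\<And>y. y \<in> F - A \<Longrightarrow> g y \<in> \<U> \<and> y \<notin> g y" by metis
    define U where "U = \<Inter>(insert (topspace R) (g ` (F - A)))"
    have "openin R U"
      unfolding U_def by (rule openin_Inter) (use F(1) \<U>(1) g in auto)
    moreover have "A \<subseteq> U" unfolding U_def using \<U>(2) g by blast
    moreover have "U \<inter> F \<subseteq> A" unfolding U_def using g by blast
    ultimately show ?thesis by blast
  qed
  then show "A \<in> cantor_closure R" using \<U>(2) by (auto simp: cantor_closure_pointwise)
qed

end

theory Submission
  imports Defs
begin

text \<open>
  A topology \<open>T\<close> in the interval of \<open>\<rho>\<close> has the same point closures as \<open>\<rho>\<close>, and a topology
  \<open>S\<close> on the same set that is coarser than \<open>T\<close> lies in the interval exactly when these point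
  closures are \<open>S\<close>-closed. So the interval behaves like the \<open>T\<^sub>1\<close> topologies on the set of
  point closures, and the theorem is the analogue, without a separation axiom on points, of the
  Berri--Sorgenfrey characterization of minimal regular spaces. Each direction translates
  between regular filters and strictly coarser regular topologies.

  If \<open>S\<close> is a regular member of the interval strictly below \<open>\<tau>\<close>, then some point \<open>x\<close> has fewer
  \<open>S\<close>-neighbourhoods than \<open>\<tau>\<close>-neighbourhoods. The \<open>\<tau>\<close>-open sets that are \<open>S\<close>-neighbourhoods of
  \<open>x\<close> form a \<open>\<tau>\<close>-regular filter whose adherence is the closure of \<open>x\<close>; its convergence
  would return all the \<open>\<tau>\<close>-neighbourhoods of \<open>x\<close> (\<open>coarser_regular_eq\<close>).

  Conversely, let \<open>\<F>\<close> be a \<open>\<tau>\<close>-regular filter that adheres exactly to the closure of \<open>x\<close> but does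
  not converge. Keep only those \<open>\<tau>\<close>-open sets that belong to \<open>\<F>\<close> whenever they contain \<open>x\<close>; this
  forces \<open>\<F>\<close> to converge to \<open>x\<close>. The resulting topology is strictly coarser, it keeps the point
  closures closed because \<open>\<F>\<close> adheres to no other point closure, and it stays regular because
  \<open>\<F>\<close> is a regular filter.
\<close>

section \<open>Point closures and the interval of a topology\<close>

lemma regular_space_shrink:
  assumes "regular_space T" "openin T V" "x \<in> V"
  obtains U where "openin T U" "x \<in> U" "T closure_of U \<subseteq> V"
  using assms unfolding regular_space_iff_open_closure by metis

lemma regular_space_closure_of_point_subset:
  assumes "regular_space T" "openin T V" "x \<in> V"
  shows "T closure_of {x} \<subseteq> V"
proof -
  obtain U where U: "openin T U" "x \<in> U" "T closure_of U \<subseteq> V"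
    using regular_space_shrink [OF assms] .
  then have "T closure_of {x} \<subseteq> T closure_of U"
    by (intro closure_of_mono) simp
  with U(3) show ?thesis by blast
qed

lemma in_closure_of_point_imp_in_open:
  assumes "y \<in> T closure_of {x}" "openin T U" "y \<in> U"
  shows "x \<in> U"
  using assms by (auto simp: in_closure_of)

lemma regular_space_closure_of_point_iff_in_open:
  assumes "regular_space T" "openin T U" "y \<in> T closure_of {x}"
  shows "y \<in> U \<longleftrightarrow> x \<in> U"
  using assms regular_space_closure_of_point_subset in_closure_of_point_imp_in_open
  by (metis subsetD)

lemma in_closure_of_point_self: "x \<in> topspace T \<Longrightarrow> x \<in> T closure_of {x}"
  by (auto simp: in_closure_of)

text \<open>
  The closure of a finite set is a finite union of point closures, so the whole space and the
  complements of point closures already form a subbase of \<open>at(\<rho>)\<close>.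
\<close>

lemma at_topology_le_iff:
  assumes "topspace T = topspace R"
  shows "(\<forall>U. openin (at_topology R) U \<longrightarrow> openin T U) \<longleftrightarrow>
           (\<forall>x \<in> topspace R. closedin T (R closure_of {x}))" (is "?L \<longleftrightarrow> ?R")
proof
  assume L: ?L
  show ?R
  proof
    fix x assume x: "x \<in> topspace R"
    have "openin (at_topology R) (topspace R - R closure_of {x})"
      unfolding at_topology_def using x
      by (intro topology_generated_by_Basis CollectI exI [of _ "{x}"]) auto
    then have "openin T (topspace T - R closure_of {x})"
      using L assms by auto
    then show "closedin T (R closure_of {x})"
      by (simp add: closedin_def assms closure_of_subset_topspace)
  qed
next
  assume R: ?R
  have fin: "openin T (topspace R - R closure_of H)" if H: "finite H" "H \<subseteq> topspace R" for H
  proof -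
    have "R closure_of H = \<Union> ((\<lambda>x. R closure_of {x}) ` H)"
      using closure_of_Union [of "(\<lambda>x. {x}) ` H" R] H(1) by simp
    moreover have "closedin T (\<Union> ((\<lambda>x. R closure_of {x}) ` H))"
      using H R by (intro closedin_Union) auto
    ultimately show ?thesis
      using assms by (metis openin_diff openin_topspace)
  qed
  show ?L
  proof (intro allI impI)
    fix U assume "openin (at_topology R) U"
    then have "generate_topology_on {topspace R - R closure_of H | H. finite H \<and> H \<subseteq> topspace R} U"
      by (simp add: at_topology_def openin_topology_generated_by_iff)
    then show "openin T U"
      by induction (use fin in auto)
  qed
qed

text \<open>
  The lower bound of the interval makes the point closures of \<open>\<rho>\<close> closed. The upper bound consists
  of intersections of \<open>\<rho>\<close>-open sets, so it cannot separate a point of \<open>cl\<^sub>\<rho>(x)\<close> from \<open>x\<close>.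
\<close>

lemma topology_interval_closure_of_point:
  assumes T: "T \<in> topology_interval R" and x: "x \<in> topspace R"
  shows "T closure_of {x} = R closure_of {x}"
proof
  have top: "topspace T = topspace R" using T by (simp add: topology_interval_def)
  have "closedin T (R closure_of {x})"
    using at_topology_le_iff [OF top] T x by (auto simp: topology_interval_def)
  then show "T closure_of {x} \<subseteq> R closure_of {x}"
    using in_closure_of_point_self [OF x] by (intro closure_of_minimal) auto
  show "R closure_of {x} \<subseteq> T closure_of {x}"
  proof
    fix y assume y: "y \<in> R closure_of {x}"
    have "x \<in> U" if U: "openin T U" "y \<in> U" for U
    proof -
      have "U \<in> cantor_closure R" using T U(1) by (auto simp: topology_interval_def)
      then obtain \<U> where \<U>: "\<forall>V \<in> \<U>. openin R V" "U = topspace R \<inter> \<Inter>\<U>"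
        unfolding cantor_closure_eq_Inter by blast
      then show ?thesis
        using x y U(2) in_closure_of_point_imp_in_open [of y R x] by blast
    qed
    moreover have "y \<in> topspace T"
      using y top closure_of_subset_topspace [of R "{x}"] by auto
    ultimately show "y \<in> T closure_of {x}" by (auto simp: in_closure_of)
  qed
qed

lemma coarser_in_topology_interval_iff:
  assumes T: "T \<in> topology_interval R"
    and top: "topspace S = topspace T"
    and le: "\<And>U. openin S U \<Longrightarrow> openin T U"
  shows "S \<in> topology_interval R \<longleftrightarrow> (\<forall>x \<in> topspace T. closedin S (T closure_of {x}))"
proof -
  have topT: "topspace T = topspace R" using T by (simp add: topology_interval_def)
  have "S \<in> topology_interval R \<longleftrightarrow> (\<forall>U. openin (at_topology R) U \<longrightarrow> openin S U)"
    using T top le by (auto simp: topology_interval_def)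
  also have "\<dots> \<longleftrightarrow> (\<forall>x \<in> topspace R. closedin S (R closure_of {x}))"
    using at_topology_le_iff top topT by metis
  also have "\<dots> \<longleftrightarrow> (\<forall>x \<in> topspace T. closedin S (T closure_of {x}))"
    using topology_interval_closure_of_point [OF T] topT by simp
  finally show ?thesis .
qed

section \<open>Convergence and adherence of open filters\<close>

lemma open_filter_Int: "open_filter T F \<Longrightarrow> U \<in> F \<Longrightarrow> V \<in> F \<Longrightarrow> U \<inter> V \<in> F"
  unfolding open_filter_def by blast

lemma open_filter_superset: "open_filter T F \<Longrightarrow> U \<in> F \<Longrightarrow> openin T V \<Longrightarrow> U \<subseteq> V \<Longrightarrow> V \<in> F"
  unfolding open_filter_def by blast

lemma open_filter_openin: "open_filter T F \<Longrightarrow> U \<in> F \<Longrightarrow> openin T U"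
  unfolding open_filter_def by blast

lemma open_filter_nonempty: "open_filter T F \<Longrightarrow> U \<in> F \<Longrightarrow> U \<noteq> {}"
  unfolding open_filter_def by blast

lemma converges_to_imp_in_adherence:
  assumes F: "open_filter T F" and z: "z \<in> topspace T" "converges_to T F z"
  shows "z \<in> adherence T F"
  unfolding adherence_def
proof
  fix U assume U: "U \<in> F"
  have "\<exists>y. y \<in> U \<and> y \<in> V" if "z \<in> V" "openin T V" for V
  proof -
    have "V \<in> F" using z(2) that by (auto simp: converges_to_def open_nhds_def)
    then have "U \<inter> V \<noteq> {}"
      by (intro open_filter_nonempty [OF F] open_filter_Int [OF F U])
    then show ?thesis by blast
  qed
  then show "z \<in> T closure_of U" using z(1) by (simp add: in_closure_of)
qed

text \<open>
  In a regular space, the points of one point closure have the same open neighbourhoods; a limit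
  adheres to the filter, so it lies in the point closure of \<open>x\<close>.
\<close>

lemma convergent_imp_converges_to_point_closure:
  assumes T: "regular_space T" and F: "open_filter T F"
    and adh: "adherence T F = T closure_of {x}"
    and conv: "is_convergent T F" and y: "y \<in> T closure_of {x}"
  shows "converges_to T F y"
proof -
  obtain z where z: "z \<in> topspace T" "converges_to T F z"
    using conv by (auto simp: is_convergent_def)
  then have "z \<in> T closure_of {x}"
    using converges_to_imp_in_adherence [OF F] adh by blast
  then have "open_nhds T y = open_nhds T z"
    using regular_space_closure_of_point_iff_in_open [OF T] y by (auto simp: open_nhds_def)
  with z(2) show ?thesis by (simp add: converges_to_def)
qed

section \<open>From a coarser regular topology to a regular filter\<close>

text \<open>
  If \<open>V\<close> is \<open>T\<close>-open and \<open>x \<in> V\<close>, the \<open>T\<close>-open sets that are \<open>S\<close>-neighbourhoods of \<open>x\<close> form a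
  \<open>T\<close>-regular filter, because \<open>S\<close> is regular and \<open>S\<close>-closures contain \<open>T\<close>-closures. It adheres to
  \<open>y\<close> only if \<open>y\<close> lies in the point closure of \<open>x\<close>: otherwise regularity of \<open>S\<close> separates \<open>x\<close>
  from the \<open>S\<close>-closed set \<open>cl\<^sub>T(y)\<close>. Convergence puts \<open>V\<close> in this filter, which makes \<open>V\<close> an
  \<open>S\<close>-neighbourhood of \<open>x\<close>.
\<close>

lemma coarser_regular_eq:
  assumes T: "regular_space T" and S: "regular_space S"
    and top: "topspace S = topspace T"
    and le: "\<And>U. openin S U \<Longrightarrow> openin T U"
    and closed: "\<And>x. x \<in> topspace T \<Longrightarrow> closedin S (T closure_of {x})"
    and conv: "\<And>F x. regular_filter T F \<Longrightarrow> x \<in> topspace T \<Longrightarrow>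
                  adherence T F = T closure_of {x} \<Longrightarrow> is_convergent T F"
    and V: "openin T V"
  shows "openin S V"
proof (subst openin_subopen, intro ballI)
  fix x assume xV: "x \<in> V"
  then have x: "x \<in> topspace T" using V openin_subset by blast
  define F where "F = {U. openin T U \<and> (\<exists>W. openin S W \<and> x \<in> W \<and> W \<subseteq> U)}"
  have F_nhd: "W \<in> F" if "openin S W" "x \<in> W" for W
    using that le by (auto simp: F_def)
  have top_F: "topspace S \<in> F"
    using x top by (intro F_nhd openin_topspace) simp
  have cl_le: "T closure_of A \<subseteq> S closure_of A" for A
    using le top by (auto simp: in_closure_of)
  have filter: "open_filter T F"
    unfolding open_filter_def
  proof (intro conjI ballI allI impI)
    show "F \<noteq> {}" using top_F by blast
  next
    fix U U' assume "U \<in> F" "U' \<in> F"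
    then obtain W W' where "openin T U" "openin T U'"
      "openin S W" "x \<in> W" "W \<subseteq> U" "openin S W'" "x \<in> W'" "W' \<subseteq> U'"
      by (auto simp: F_def)
    then have "openin T (U \<inter> U')" "openin S (W \<inter> W')" "x \<in> W \<inter> W'" "W \<inter> W' \<subseteq> U \<inter> U'"
      by auto
    then show "U \<inter> U' \<in> F" unfolding F_def by blast
  qed (auto simp: F_def)
  have regF: "regular_filter T F"
    unfolding regular_filter_def
  proof (intro conjI filter ballI)
    fix U assume "U \<in> F"
    then obtain W where W: "openin S W" "x \<in> W" "W \<subseteq> U" by (auto simp: F_def)
    then obtain W' where "openin S W'" "x \<in> W'" "S closure_of W' \<subseteq> W"
      using regular_space_shrink [OF S] by metis
    then show "\<exists>W' \<in> F. T closure_of W' \<subseteq> U" using F_nhd cl_le W(3) by blast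
  qed
  have adh: "adherence T F = T closure_of {x}"
  proof
    show "adherence T F \<subseteq> T closure_of {x}"
    proof (rule subsetI, rule ccontr)
      fix y assume y: "y \<in> adherence T F" "y \<notin> T closure_of {x}"
      have ytop: "y \<in> topspace T"
        using y(1) top_F by (auto simp: adherence_def in_closure_of)
      have "y \<in> topspace T - T closure_of {x}" using ytop y(2) by blast
      then have "x \<notin> T closure_of {y}"
        using regular_space_closure_of_point_iff_in_open
            [OF T openin_diff [OF openin_topspace closedin_closure_of]]
          in_closure_of_point_self [OF x] by blast
      moreover have "openin S (topspace S - T closure_of {y})"
        using closed [OF ytop] by auto
      ultimately obtain W where "openin S W" "x \<in> W" "S closure_of W \<subseteq> topspace S - T closure_of {y}"
        using regular_space_shrink [OF S] x top by (metis DiffI)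
      then have "y \<notin> T closure_of W"
        using cl_le in_closure_of_point_self [OF ytop] by blast
      with y(1) F_nhd \<open>openin S W\<close> \<open>x \<in> W\<close> show False by (auto simp: adherence_def)
    qed
    show "T closure_of {x} \<subseteq> adherence T F"
      unfolding adherence_def by (intro INT_greatest closure_of_mono) (auto simp: F_def)
  qed
  have "converges_to T F x"
    using convergent_imp_converges_to_point_closure [OF T filter adh]
      conv [OF regF x adh] in_closure_of_point_self [OF x] by blast
  then have "V \<in> F" using V xV by (auto simp: converges_to_def open_nhds_def)
  then show "\<exists>W. openin S W \<and> x \<in> W \<and> W \<subseteq> V" by (auto simp: F_def)
qed

section \<open>From a non-convergent regular filter to a coarser regular topology\<close>

text \<open>
  For an open filter \<open>F\<close>, this is the finest topology below \<open>T\<close> in which every open neighbourhood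
  of \<open>x\<close> belongs to \<open>F\<close>.
\<close>

definition attach_filter :: "'a topology \<Rightarrow> 'a set set \<Rightarrow> 'a \<Rightarrow> 'a topology" where
  "attach_filter T F x = topology (\<lambda>U. openin T U \<and> (x \<in> U \<longrightarrow> U \<in> F))"

lemma openin_attach_filter:
  assumes F: "open_filter T F"
  shows "openin (attach_filter T F x) U \<longleftrightarrow> openin T U \<and> (x \<in> U \<longrightarrow> U \<in> F)"
proof -
  have "istopology (\<lambda>U. openin T U \<and> (x \<in> U \<longrightarrow> U \<in> F))"
    unfolding istopology_def
  proof (intro conjI allI impI)
    fix \<K> assume K: "\<forall>U \<in> \<K>. openin T U \<and> (x \<in> U \<longrightarrow> U \<in> F)"
    then show op: "openin T (\<Union>\<K>)" by blast
    assume "x \<in> \<Union>\<K>"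
    then show "\<Union>\<K> \<in> F" using K op open_filter_superset [OF F] by (meson Union_upper UnionE)
  qed (use open_filter_Int [OF F] in auto)
  then show ?thesis unfolding attach_filter_def by (simp add: topology_inverse')
qed

lemma topspace_in_open_filter:
  assumes F: "open_filter T F"
  shows "topspace T \<in> F"
proof -
  obtain U where "U \<in> F" using F unfolding open_filter_def by blast
  then show ?thesis
    using open_filter_superset [OF F] open_filter_openin [OF F] openin_subset by blast
qed

lemma topspace_attach_filter:
  assumes F: "open_filter T F"
  shows "topspace (attach_filter T F x) = topspace T"
proof
  show "topspace (attach_filter T F x) \<subseteq> topspace T"
    using openin_attach_filter [OF F] openin_subset by blast
  show "topspace T \<subseteq> topspace (attach_filter T F x)"
    using openin_attach_filter [OF F] topspace_in_open_filter [OF F] openin_subset by blast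
qed

lemma closedin_attach_filter:
  assumes F: "open_filter T F" and x: "x \<in> topspace T"
  shows "closedin (attach_filter T F x) C \<longleftrightarrow> closedin T C \<and> (x \<in> C \<or> topspace T - C \<in> F)"
  using x by (auto simp: closedin_def openin_attach_filter [OF F] topspace_attach_filter [OF F])

text \<open>
  A point closure other than that of \<open>x\<close> misses some member of \<open>F\<close>, so its complement is in \<open>F\<close>.
\<close>

lemma closedin_attach_filter_closure_of_point:
  assumes T: "regular_space T" and F: "open_filter T F" and x: "x \<in> topspace T"
    and adh: "adherence T F \<subseteq> T closure_of {x}" and y: "y \<in> topspace T"
  shows "closedin (attach_filter T F x) (T closure_of {y})"
proof (cases "x \<in> T closure_of {y}")
  case True
  then show ?thesis by (simp add: closedin_attach_filter [OF F x])
next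
  case False
  have "openin T (topspace T - T closure_of {y})" by auto
  with False x have "y \<notin> T closure_of {x}"
    using in_closure_of_point_self [OF y]
      regular_space_closure_of_point_iff_in_open [OF T] by blast
  then obtain U where U: "U \<in> F" "y \<notin> T closure_of U"
    using adh by (auto simp: adherence_def)
  have opU: "openin T U" using open_filter_openin [OF F U(1)] .
  then have "U \<subseteq> T closure_of U" by (intro closure_of_subset openin_subset)
  then have "U \<inter> T closure_of {y} = {}"
    using in_closure_of_point_imp_in_open [OF _ opU] U(2) by blast
  then have "U \<subseteq> topspace T - T closure_of {y}" using openin_subset [OF opU] by blast
  then have "topspace T - T closure_of {y} \<in> F"
    by (intro open_filter_superset [OF F U(1)]) auto
  then show ?thesis by (simp add: closedin_attach_filter [OF F x])
qed

text \<open>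
  Shrinking a neighbourhood \<open>V\<close> of \<open>x\<close> takes two pieces: a \<open>T\<close>-neighbourhood of \<open>x\<close>, and a member
  of \<open>F\<close> so that the union is open again; its \<open>T\<close>-closure contains \<open>x\<close>, so it remains closed.
  For \<open>z\<close> outside \<open>cl\<^sub>T(x)\<close>, the filter does not adhere to \<open>z\<close>, so a neighbourhood of \<open>z\<close> can be
  shrunk away from some member of \<open>F\<close>, which keeps its closure closed, and away from \<open>x\<close>,
  which keeps it open. Points inside \<open>cl\<^sub>T(x)\<close> have the same neighbourhoods as \<open>x\<close>.
\<close>

lemma regular_space_attach_filter:
  assumes T: "regular_space T" and F: "regular_filter T F" and x: "x \<in> topspace T"
    and adh: "adherence T F \<subseteq> T closure_of {x}"
  shows "regular_space (attach_filter T F x)" (is "regular_space ?S")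
proof -
  have oF: "open_filter T F" using F by (simp add: regular_filter_def)
  have opS: "openin ?S U \<longleftrightarrow> openin T U \<and> (x \<in> U \<longrightarrow> U \<in> F)" for U
    by (rule openin_attach_filter [OF oF])
  have "\<exists>U C. openin ?S U \<and> closedin ?S C \<and> z \<in> U \<and> U \<subseteq> C \<and> C \<subseteq> V"
    if V: "openin ?S V" and z: "z \<in> V" for V z
  proof -
    have VT: "openin T V" using V opS by blast
    have shrunk: ?thesis
      if "openin ?S U" "closedin ?S (T closure_of U)" "z \<in> U" "T closure_of U \<subseteq> V" for U
      using that closure_of_subset openin_subset opS by metis
    show ?thesis
    proof (cases "z \<in> T closure_of {x}")
      case True
      then have same: "z \<in> U \<longleftrightarrow> x \<in> U" if "openin T U" for U
        using regular_space_closure_of_point_iff_in_open [OF T that] by blast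
      then have xV: "x \<in> V" using z VT by blast
      then have "V \<in> F" using V opS by blast
      then obtain U0 where U0: "U0 \<in> F" "T closure_of U0 \<subseteq> V"
        using F by (auto simp: regular_filter_def)
      obtain W where W: "openin T W" "x \<in> W" "T closure_of W \<subseteq> V"
        using regular_space_shrink [OF T VT xV] .
      have op: "openin T (U0 \<union> W)" using W(1) open_filter_openin [OF oF U0(1)] by blast
      show ?thesis
      proof (rule shrunk)
        show "openin ?S (U0 \<union> W)"
          using op open_filter_superset [OF oF U0(1) op] by (simp add: opS)
        have "x \<in> T closure_of (U0 \<union> W)"
          using closure_of_subset [OF openin_subset [OF op]] W(2) by blast
        then show "closedin ?S (T closure_of (U0 \<union> W))"
          by (simp only: closedin_attach_filter [OF oF x] closedin_closure_of) simp
        show "z \<in> U0 \<union> W" using same [OF op] W(2) by blast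
        show "T closure_of (U0 \<union> W) \<subseteq> V" using U0(2) W(3) by simp
      qed
    next
      case False
      then obtain U1 where U1: "U1 \<in> F" "z \<notin> T closure_of U1"
        using adh by (auto simp: adherence_def)
      let ?V' = "V - T closure_of {x} - T closure_of U1"
      have "openin T ?V'" using VT by (intro openin_diff) auto
      moreover have "z \<in> ?V'" using z False U1(2) by blast
      ultimately obtain W where W: "openin T W" "z \<in> W" "T closure_of W \<subseteq> ?V'"
        using regular_space_shrink [OF T] by metis
      have W_cl: "W \<subseteq> T closure_of W" by (intro closure_of_subset openin_subset W(1))
      have opU1: "openin T U1" using open_filter_openin [OF oF U1(1)] .
      have "U1 \<subseteq> T closure_of U1" by (intro closure_of_subset openin_subset opU1)
      then have "U1 \<subseteq> topspace T - T closure_of W"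
        using W(3) openin_subset [OF opU1] by blast
      then have compl: "topspace T - T closure_of W \<in> F"
        by (intro open_filter_superset [OF oF U1(1)]) auto
      show ?thesis
      proof (rule shrunk)
        show "openin ?S W"
          using W W_cl in_closure_of_point_self [OF x] by (auto simp: opS)
        show "closedin ?S (T closure_of W)"
          using compl by (simp add: closedin_attach_filter [OF oF x])
      qed (use W in auto)
    qed
  qed
  then show ?thesis
    unfolding neighbourhood_base_of_closedin [symmetric] neighbourhood_base_of by simp
qed

section \<open>Minimal regular members of the interval\<close>

theorem theorem3p13:
  fixes X :: "'a set" and \<rho> \<tau> :: "'a topology"
  assumes "topspace \<rho> = X"
    and "R0_space \<rho>"
    and "\<exists>\<C> \<subseteq> point_closures \<rho>. infinite \<C> \<and> disjoint \<C> \<and> \<Union>\<C> = X"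
    and "\<tau> \<in> topology_interval \<rho>"
    and "regular_space \<tau>"
  shows "(minimal_regular_in (topology_interval \<rho>) \<tau> \<longleftrightarrow>
           (\<forall>\<F>. regular_filter \<tau> \<F> \<and> (\<exists>x \<in> X. adherence \<tau> \<F> = \<tau> closure_of {x})
                 \<longrightarrow> is_convergent \<tau> \<F>))
       \<and> (\<forall>\<F>. \<forall>x \<in> X. regular_filter \<tau> \<F> \<and> adherence \<tau> \<F> = \<tau> closure_of {x}
                 \<and> is_convergent \<tau> \<F>
                 \<longrightarrow> (\<forall>y \<in> \<tau> closure_of {x}. converges_to \<tau> \<F> y))"
proof (intro conjI allI ballI impI)
  have top: "topspace \<tau> = X" using assms(1,4) by (simp add: topology_interval_def)
  show "minimal_regular_in (topology_interval \<rho>) \<tau> \<longleftrightarrow>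
          (\<forall>\<F>. regular_filter \<tau> \<F> \<and> (\<exists>x \<in> X. adherence \<tau> \<F> = \<tau> closure_of {x})
                 \<longrightarrow> is_convergent \<tau> \<F>)"
  proof (intro iffI allI impI)
    fix \<F> assume min: "minimal_regular_in (topology_interval \<rho>) \<tau>"
      and "regular_filter \<tau> \<F> \<and> (\<exists>x \<in> X. adherence \<tau> \<F> = \<tau> closure_of {x})"
    then obtain x where F: "regular_filter \<tau> \<F>" and x: "x \<in> topspace \<tau>"
      and adh: "adherence \<tau> \<F> = \<tau> closure_of {x}" using top by blast
    have oF: "open_filter \<tau> \<F>" using F by (simp add: regular_filter_def)
    let ?S = "attach_filter \<tau> \<F> x"
    note opS = openin_attach_filter [OF oF, of x]
    have le: "openin \<tau> U" if "openin ?S U" for U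
      using that opS by simp
    have "closedin ?S (\<tau> closure_of {y})" if "y \<in> topspace \<tau>" for y
      using closedin_attach_filter_closure_of_point [OF assms(5) oF x _ that] adh by simp
    then have "?S \<in> topology_interval \<rho>"
      using coarser_in_topology_interval_iff
          [OF assms(4) topspace_attach_filter [OF oF] le] by blast
    moreover have "regular_space ?S"
      using regular_space_attach_filter [OF assms(5) F x] adh by simp
    ultimately have "\<not> {U. openin ?S U} \<subset> {U. openin \<tau> U}"
      using min by (auto simp: minimal_regular_in_def)
    then have "openin ?S U" if "openin \<tau> U" for U
      using opS that by blast
    then have "converges_to \<tau> \<F> x"
      using opS by (auto simp: converges_to_def open_nhds_def)
    then show "is_convergent \<tau> \<F>" using x by (auto simp: is_convergent_def)
  next
    assume conv: "\<forall>\<F>. regular_filter \<tau> \<F> \<and> (\<exists>x \<in> X. adherence \<tau> \<F> = \<tau> closure_of {x})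
                 \<longrightarrow> is_convergent \<tau> \<F>"
    have "\<not> {U. openin S U} \<subset> {U. openin \<tau> U}"
      if S: "S \<in> topology_interval \<rho>" "regular_space S" for S
    proof
      assume less: "{U. openin S U} \<subset> {U. openin \<tau> U}"
      then have le: "openin \<tau> U" if "openin S U" for U using that by blast
      have topS: "topspace S = topspace \<tau>"
        using S(1) assms(4) by (simp add: topology_interval_def)
      have "closedin S (\<tau> closure_of {x})" if "x \<in> topspace \<tau>" for x
        using coarser_in_topology_interval_iff [OF assms(4) topS le] S(1) that by blast
      then have "openin S V" if "openin \<tau> V" for V
        using coarser_regular_eq [OF assms(5) S(2) topS le _ _ that] conv top by blast
      with less show False by blast
    qed
    then show "minimal_regular_in (topology_interval \<rho>) \<tau>"
      using assms(4,5) by (auto simp: minimal_regular_in_def)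
  qed
next
  fix \<F> x y
  assume "regular_filter \<tau> \<F> \<and> adherence \<tau> \<F> = \<tau> closure_of {x} \<and> is_convergent \<tau> \<F>"
    and "y \<in> \<tau> closure_of {x}"
  then show "converges_to \<tau> \<F> y"
    using convergent_imp_converges_to_point_closure [OF assms(5)]
    by (auto simp: regular_filter_def)
qed

end
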